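(* Let $k$ be a field, $q\in k^\times$, and let $\{d_i\}_{i=0}^\infty$ be a sequence of $k$-linear maps on a $k$-algebra $R$ with $d_0=\mathrm{id}_R$. Let $\tau$ be a $k$-linear automorphism of $R$, and let $R[[x;\tau^{-1}]]$ be the skew power series ring in which coefficients are written on the right of the variable $x$ and $rx=x\tau(r)$ for all $r\in R$. (a) Then $\{d_i\}$ is a higher $\tau$-derivation on $R$ if and only if the map $\Psi:R\to R[[x;\tau^{-1}]]$ given by $r\mapsto\sum_{i=0}^\infty x^id_i(r)$ is a ring homomorphism. (b) Extend $\tau$ to an automorphism of $R[[x;\tau^{-1}]]$ such that $\tau(x)=xq$ (so $\tau(\sum x^ir_i)=\sum x^iq^i\tau(r_i)$). Assume that $\{d_i\}$ is a higher $\tau$-derivation. Then $\{d_i\}$ is a higher $q$-skew $\tau$-derivation if and only if $\tau\circ\Psi=\Psi\circ\tau$ as maps $R\to R[[x;\tau^{-1}]]$.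
   Context: A higher $\tau$-derivation on a $k$-algebra $R$ is a sequence $d_0,d_1,d_2,\dots$ of $k$-linear operators on $R$ such that $d_0$ is the identity and $d_n(rs)=\sum_{i=0}^n\tau^{n-i}d_i(r)\,d_{n-i}(s)$ for all $r,s\in R$ and all $n$. It is a higher $q$-skew $\tau$-derivation if in addition $d_i\tau=q^i\tau d_i$ for all $i$. Rings are unital and ring homomorphisms preserve $1$; automorphisms are $k$-algebra automorphisms. *)

theory Defs
  imports "HOL-Algebra.Module" "HOL-Algebra.QuotRing"
begin

text \<open>
  The library locale \<open>algebra\<close> requires a commutative ring; here the algebra is an arbitrary
  unital ring. The zero ring is allowed.
\<close>

locale field_algebra = K?: field K + R?: ring R + module K R
  for K :: "('k, 'c) ring_scheme" (structure) and R :: "('k, 'a, 'm) module_scheme" (structure) +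
  assumes smult_mult_left:
      "\<lbrakk>a \<in> carrier K; r \<in> carrier R; s \<in> carrier R\<rbrakk> \<Longrightarrow>
        (a \<odot>\<^bsub>R\<^esub> r) \<otimes>\<^bsub>R\<^esub> s = a \<odot>\<^bsub>R\<^esub> (r \<otimes>\<^bsub>R\<^esub> s)"
    and smult_mult_right:
      "\<lbrakk>a \<in> carrier K; r \<in> carrier R; s \<in> carrier R\<rbrakk> \<Longrightarrow>
        r \<otimes>\<^bsub>R\<^esub> (a \<odot>\<^bsub>R\<^esub> s) = a \<odot>\<^bsub>R\<^esub> (r \<otimes>\<^bsub>R\<^esub> s)"

definition linear_maps ::
  "('k, 'c) ring_scheme \<Rightarrow> ('k, 'a, 'm) module_scheme \<Rightarrow> ('k, 'b, 'n) module_scheme \<Rightarrow> ('a \<Rightarrow> 'b) set"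
  where "linear_maps K M N =
    {f \<in> carrier M \<rightarrow> carrier N.
      (\<forall>x\<in>carrier M. \<forall>y\<in>carrier M. f (x \<oplus>\<^bsub>M\<^esub> y) = f x \<oplus>\<^bsub>N\<^esub> f y) \<and>
      (\<forall>a\<in>carrier K. \<forall>x\<in>carrier M. f (a \<odot>\<^bsub>M\<^esub> x) = a \<odot>\<^bsub>N\<^esub> f x)}"

definition algebra_automorphisms ::
  "('k, 'c) ring_scheme \<Rightarrow> ('k, 'a, 'm) module_scheme \<Rightarrow> ('a \<Rightarrow> 'a) set"
  where "algebra_automorphisms K R = ring_iso R R \<inter> linear_maps K R R"

definition higher_derivation ::
  "('k, 'c) ring_scheme \<Rightarrow> ('k, 'a, 'm) module_scheme \<Rightarrow> ('a \<Rightarrow> 'a) \<Rightarrow> (nat \<Rightarrow> 'a \<Rightarrow> 'a) \<Rightarrow> bool"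
  where "higher_derivation K R \<tau> d \<longleftrightarrow>
    (\<forall>n. d n \<in> linear_maps K R R) \<and>
    (\<forall>r\<in>carrier R. d 0 r = r) \<and>
    (\<forall>n. \<forall>r\<in>carrier R. \<forall>s\<in>carrier R.
      d n (r \<otimes>\<^bsub>R\<^esub> s) = (\<Oplus>\<^bsub>R\<^esub>i\<in>{..n}. (\<tau> ^^ (n - i)) (d i r) \<otimes>\<^bsub>R\<^esub> d (n - i) s))"

definition higher_q_skew_derivation ::
  "('k, 'c) ring_scheme \<Rightarrow> ('k, 'a, 'm) module_scheme \<Rightarrow> 'k \<Rightarrow> ('a \<Rightarrow> 'a) \<Rightarrow> (nat \<Rightarrow> 'a \<Rightarrow> 'a) \<Rightarrow> bool"
  where "higher_q_skew_derivation K R q \<tau> d \<longleftrightarrow>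
    higher_derivation K R \<tau> d \<and>
    (\<forall>i. \<forall>r\<in>carrier R. d i (\<tau> r) = (q [^]\<^bsub>K\<^esub> i) \<odot>\<^bsub>R\<^esub> \<tau> (d i r))"

text \<open>
  \<open>skew_power_series R \<tau>\<close> is $R[[x;\tau^{-1}]]$ with coefficients on the right of \<open>x\<close> and
  \<open>r x = x \<tau>(r)\<close>. The series $\sum_i x^i r_i$ is represented by its coefficient sequence
  \<open>i \<mapsto> r\<^sub>i\<close>. From $r x^j = x^j \tau^j(r)$ one gets
  $(\sum_i x^i r_i)(\sum_j x^j s_j) = \sum_n x^n \sum_{i\le n} \tau^{n-i}(r_i) s_{n-i}$.
\<close>

definition skew_power_series ::
  "('k, 'a, 'm) module_scheme \<Rightarrow> ('a \<Rightarrow> 'a) \<Rightarrow> ('k, nat \<Rightarrow> 'a) module"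
  where "skew_power_series R \<tau> =
    \<lparr>carrier = UNIV \<rightarrow> carrier R,
     mult = (\<lambda>f g n. \<Oplus>\<^bsub>R\<^esub>i\<in>{..n}. (\<tau> ^^ (n - i)) (f i) \<otimes>\<^bsub>R\<^esub> g (n - i)),
     one = (\<lambda>n. if n = 0 then \<one>\<^bsub>R\<^esub> else \<zero>\<^bsub>R\<^esub>),
     zero = (\<lambda>n. \<zero>\<^bsub>R\<^esub>),
     add = (\<lambda>f g n. f n \<oplus>\<^bsub>R\<^esub> g n),
     smult = (\<lambda>a f n. a \<odot>\<^bsub>R\<^esub> f n)\<rparr>"

definition series_map :: "(nat \<Rightarrow> 'a \<Rightarrow> 'a) \<Rightarrow> 'a \<Rightarrow> nat \<Rightarrow> 'a"  \<comment> \<open>the map \<open>\<Psi>\<close>\<close>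
  where "series_map d r = (\<lambda>i. d i r)"

text \<open>The extension of \<open>\<tau>\<close> to the skew power series ring with \<open>\<tau>(x) = x q\<close>.\<close>

definition extend_aut ::
  "('k, 'c) ring_scheme \<Rightarrow> ('k, 'a, 'm) module_scheme \<Rightarrow> 'k \<Rightarrow> ('a \<Rightarrow> 'a) \<Rightarrow> (nat \<Rightarrow> 'a) \<Rightarrow> nat \<Rightarrow> 'a"
  where "extend_aut K R q \<tau> f = (\<lambda>i. (q [^]\<^bsub>K\<^esub> i) \<odot>\<^bsub>R\<^esub> \<tau> (f i))"

definition series_monom :: "('a, 'm) ring_scheme \<Rightarrow> nat \<Rightarrow> 'a \<Rightarrow> nat \<Rightarrow> 'a"  \<comment> \<open>\<open>x\<^sup>n r\<close>\<close>
  where "series_monom R n r = (\<lambda>i. if i = n then r else \<zero>\<^bsub>R\<^esub>)"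


lemma (in abelian_monoid) finsum_triangle:
  assumes F: "\<And>i j. F i j \<in> carrier G"
  shows "(\<Oplus>j\<in>{..k}. \<Oplus>i\<in>{..j}. F i (j - i)) = (\<Oplus>i\<in>{..k::nat}. \<Oplus>l\<in>{..k - i}. F i l)"
proof (induct k)
  case 0
  then show ?case using F by (simp add: Pi_def)
next
  case (Suc k)
  have F': "(\<lambda>i. F i (m i)) \<in> A \<rightarrow> carrier G" for m A using F by auto
  have F'': "F i \<in> A \<rightarrow> carrier G" for i A using F by auto
  have S: "(\<lambda>i. \<Oplus>l\<in>{..m i}. F i l) \<in> A \<rightarrow> carrier G" for m :: "nat \<Rightarrow> nat" and A
    using F'' by (auto intro: finsum_closed)
  have "(\<Oplus>i\<in>{..k}. \<Oplus>l\<in>{..Suc k - i}. F i l)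
      = (\<Oplus>i\<in>{..k}. F i (Suc k - i) \<oplus> (\<Oplus>l\<in>{..k - i}. F i l))"
    using F F' F'' S by (intro finsum_cong') (auto simp: Suc_diff_le intro!: finsum_closed)
  also have "\<dots> = (\<Oplus>i\<in>{..k}. F i (Suc k - i)) \<oplus> (\<Oplus>i\<in>{..k}. \<Oplus>l\<in>{..k - i}. F i l)"
    using F' S by (intro finsum_addf)
  finally have *: "(\<Oplus>i\<in>{..k}. \<Oplus>l\<in>{..Suc k - i}. F i l)
      = (\<Oplus>i\<in>{..k}. F i (Suc k - i)) \<oplus> (\<Oplus>i\<in>{..k}. \<Oplus>l\<in>{..k - i}. F i l)" .
  have "(\<Oplus>j\<in>{..Suc k}. \<Oplus>i\<in>{..j}. F i (j - i))
     = (\<Oplus>i\<in>{..Suc k}. F i (Suc k - i)) \<oplus> (\<Oplus>i\<in>{..k}. \<Oplus>l\<in>{..k - i}. F i l)"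
    using F' by (subst finsum_Suc) (auto simp: Suc intro!: finsum_closed)
  also have "\<dots> = F (Suc k) 0 \<oplus> (\<Oplus>i\<in>{..k}. F i (Suc k - i)) \<oplus> (\<Oplus>i\<in>{..k}. \<Oplus>l\<in>{..k - i}. F i l)"
    using F' by (subst finsum_Suc) auto
  also have "\<dots> = F (Suc k) 0 \<oplus> (\<Oplus>i\<in>{..k}. \<Oplus>l\<in>{..Suc k - i}. F i l)"
    unfolding * using F F' S by (intro a_assoc finsum_closed) auto
  also have "\<dots> = (\<Oplus>i\<in>{..Suc k}. \<Oplus>l\<in>{..Suc k - i}. F i l)"
    using F F'' S by (subst finsum_Suc[OF S]) auto
  finally show ?case .
qed

lemma (in abelian_monoid) finsum_zero_except:
  assumes "finite A" "i \<in> A" "f i \<in> carrier G" "\<And>j. j \<in> A \<Longrightarrow> j \<noteq> i \<Longrightarrow> f j = \<zero>"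
  shows "(\<Oplus>j\<in>A. f j) = f i"
proof -
  have "(\<Oplus>j\<in>A. f j) = (\<Oplus>j\<in>A. if i = j then f j else \<zero>)"
    using assms by (intro finsum_cong') auto
  also have "\<dots> = f i"
    using assms finsum_singleton[of i A "\<lambda>_. f i"]
    by (subst finsum_cong'[of A A "\<lambda>j. if i = j then f i else \<zero>"]) auto
  finally show ?thesis .
qed

locale skew_series = field_algebra K R
  for K :: "('k, 'c) ring_scheme" (structure) and R :: "('k, 'a, 'm) module_scheme" (structure) +
  fixes \<tau> :: "'a \<Rightarrow> 'a"
  assumes aut: "\<tau> \<in> algebra_automorphisms K R"
begin

abbreviation S where "S \<equiv> skew_power_series R \<tau>"

lemma tau_closed [simp]: "r \<in> carrier R \<Longrightarrow> \<tau> r \<in> carrier R"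
  and tau_mult: "r \<in> carrier R \<Longrightarrow> s \<in> carrier R \<Longrightarrow> \<tau> (r \<otimes>\<^bsub>R\<^esub> s) = \<tau> r \<otimes>\<^bsub>R\<^esub> \<tau> s"
  and tau_add: "r \<in> carrier R \<Longrightarrow> s \<in> carrier R \<Longrightarrow> \<tau> (r \<oplus>\<^bsub>R\<^esub> s) = \<tau> r \<oplus>\<^bsub>R\<^esub> \<tau> s"
  and tau_smult: "a \<in> carrier K \<Longrightarrow> r \<in> carrier R \<Longrightarrow> \<tau> (a \<odot>\<^bsub>R\<^esub> r) = a \<odot>\<^bsub>R\<^esub> \<tau> r"
  and tau_one [simp]: "\<tau> \<one>\<^bsub>R\<^esub> = \<one>\<^bsub>R\<^esub>"
  and tau_bij: "bij_betw \<tau> (carrier R) (carrier R)"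
  using aut unfolding algebra_automorphisms_def ring_iso_def linear_maps_def ring_hom_def
  by auto

lemma tau_zero [simp]: "\<tau> \<zero>\<^bsub>R\<^esub> = \<zero>\<^bsub>R\<^esub>"
proof -
  have "\<tau> \<zero>\<^bsub>R\<^esub> \<oplus>\<^bsub>R\<^esub> \<tau> \<zero>\<^bsub>R\<^esub> = \<tau> \<zero>\<^bsub>R\<^esub>"
    using tau_add[of "\<zero>\<^bsub>R\<^esub>" "\<zero>\<^bsub>R\<^esub>"] by simp
  then show ?thesis
    by (metis R.add.l_cancel_one' R.zero_closed tau_closed)
qed

lemma pow_closed [simp]: "r \<in> carrier R \<Longrightarrow> (\<tau> ^^ n) r \<in> carrier R"
  by (induct n) auto

lemma pow_mult: "r \<in> carrier R \<Longrightarrow> s \<in> carrier R \<Longrightarrow> (\<tau> ^^ n) (r \<otimes>\<^bsub>R\<^esub> s) = (\<tau> ^^ n) r \<otimes>\<^bsub>R\<^esub> (\<tau> ^^ n) s"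
  and pow_add: "r \<in> carrier R \<Longrightarrow> s \<in> carrier R \<Longrightarrow> (\<tau> ^^ n) (r \<oplus>\<^bsub>R\<^esub> s) = (\<tau> ^^ n) r \<oplus>\<^bsub>R\<^esub> (\<tau> ^^ n) s"
  and pow_smult: "a \<in> carrier K \<Longrightarrow> r \<in> carrier R \<Longrightarrow> (\<tau> ^^ n) (a \<odot>\<^bsub>R\<^esub> r) = a \<odot>\<^bsub>R\<^esub> (\<tau> ^^ n) r"
  and pow_one [simp]: "(\<tau> ^^ n) \<one>\<^bsub>R\<^esub> = \<one>\<^bsub>R\<^esub>"
  and pow_zero [simp]: "(\<tau> ^^ n) \<zero>\<^bsub>R\<^esub> = \<zero>\<^bsub>R\<^esub>"
  by (induct n) (auto simp: tau_mult tau_add tau_smult)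

lemma tau_finsum:
  "f \<in> {..m::nat} \<rightarrow> carrier R \<Longrightarrow> \<tau> (\<Oplus>\<^bsub>R\<^esub>i\<in>{..m}. f i) = (\<Oplus>\<^bsub>R\<^esub>i\<in>{..m}. \<tau> (f i))"
proof (induct m)
  case (Suc m)
  then have *: "f \<in> {..m} \<rightarrow> carrier R" by auto
  have "f (Suc m) \<in> carrier R" "(\<lambda>i. \<tau> (f i)) \<in> {..Suc m} \<rightarrow> carrier R"
    using Suc(2) by (auto simp: Pi_iff)
  then show ?case
    using Suc * by (simp add: tau_add R.finsum_closed)
qed simp

lemma pow_finsum:
  assumes "f \<in> {..m::nat} \<rightarrow> carrier R"
  shows "(\<tau> ^^ n) (\<Oplus>\<^bsub>R\<^esub>i\<in>{..m}. f i) = (\<Oplus>\<^bsub>R\<^esub>i\<in>{..m}. (\<tau> ^^ n) (f i))"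
proof (induct n)
  case (Suc n)
  have "(\<lambda>i. (\<tau> ^^ n) (f i)) \<in> {..m} \<rightarrow> carrier R" using assms by (auto simp: Pi_iff)
  then show ?case using Suc by (simp add: tau_finsum)
qed simp

lemma smult_finsum:
  "a \<in> carrier K \<Longrightarrow> f \<in> {..m::nat} \<rightarrow> carrier R \<Longrightarrow>
    a \<odot>\<^bsub>R\<^esub> (\<Oplus>\<^bsub>R\<^esub>i\<in>{..m}. f i) = (\<Oplus>\<^bsub>R\<^esub>i\<in>{..m}. a \<odot>\<^bsub>R\<^esub> f i)"
proof (induct m)
  case (Suc m)
  then have *: "f \<in> {..m} \<rightarrow> carrier R" by auto
  have "f (Suc m) \<in> carrier R" "(\<lambda>i. a \<odot>\<^bsub>R\<^esub> f i) \<in> {..Suc m} \<rightarrow> carrier R"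
    using Suc(2,3) by auto
  then show ?case
    using Suc * by (simp add: smult_r_distr R.finsum_closed)
qed simp

lemma S_simps:
  "carrier S = UNIV \<rightarrow> carrier R"
  "(f \<otimes>\<^bsub>S\<^esub> g) = (\<lambda>n. \<Oplus>\<^bsub>R\<^esub>i\<in>{..n}. (\<tau> ^^ (n - i)) (f i) \<otimes>\<^bsub>R\<^esub> g (n - i))"
  "\<one>\<^bsub>S\<^esub> = (\<lambda>n. if n = 0 then \<one>\<^bsub>R\<^esub> else \<zero>\<^bsub>R\<^esub>)"
  "\<zero>\<^bsub>S\<^esub> = (\<lambda>n. \<zero>\<^bsub>R\<^esub>)"
  "(f \<oplus>\<^bsub>S\<^esub> g) = (\<lambda>n. f n \<oplus>\<^bsub>R\<^esub> g n)"
  "(a \<odot>\<^bsub>S\<^esub> f) = (\<lambda>n. a \<odot>\<^bsub>R\<^esub> f n)"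
  by (simp_all add: skew_power_series_def)

lemma S_mult_closed: "f \<in> carrier S \<Longrightarrow> g \<in> carrier S \<Longrightarrow> f \<otimes>\<^bsub>S\<^esub> g \<in> carrier S"
  by (auto simp: S_simps Pi_iff intro!: R.finsum_closed)

lemma S_mult_assoc:
  assumes "f \<in> carrier S" "g \<in> carrier S" "h \<in> carrier S"
  shows "(f \<otimes>\<^bsub>S\<^esub> g) \<otimes>\<^bsub>S\<^esub> h = f \<otimes>\<^bsub>S\<^esub> (g \<otimes>\<^bsub>S\<^esub> h)"
proof
  fix n
  have c [simp]: "f i \<in> carrier R" "g i \<in> carrier R" "h i \<in> carrier R" for i
    using assms by (auto simp: S_simps)
  define F where "F i l = (\<tau> ^^ (n - i)) (f i) \<otimes>\<^bsub>R\<^esub> ((\<tau> ^^ (n - i - l)) (g l) \<otimes>\<^bsub>R\<^esub> h (n - i - l))" for i l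
  have F [simp]: "F i l \<in> carrier R" for i l by (simp add: F_def)
  have "((f \<otimes>\<^bsub>S\<^esub> g) \<otimes>\<^bsub>S\<^esub> h) n = (\<Oplus>\<^bsub>R\<^esub>j\<in>{..n}. \<Oplus>\<^bsub>R\<^esub>i\<in>{..j}. F i (j - i))"
    unfolding S_simps
  proof (rule R.finsum_cong')
    fix j assume j: "j \<in> {..n}"
    have "(\<tau> ^^ (n - j)) (\<Oplus>\<^bsub>R\<^esub>i\<in>{..j}. (\<tau> ^^ (j - i)) (f i) \<otimes>\<^bsub>R\<^esub> g (j - i)) \<otimes>\<^bsub>R\<^esub> h (n - j)
       = (\<Oplus>\<^bsub>R\<^esub>i\<in>{..j}. (\<tau> ^^ (n - j)) ((\<tau> ^^ (j - i)) (f i) \<otimes>\<^bsub>R\<^esub> g (j - i)) \<otimes>\<^bsub>R\<^esub> h (n - j))"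
      by (subst pow_finsum) (auto simp: Pi_def intro!: R.finsum_ldistr)
    also have "\<dots> = (\<Oplus>\<^bsub>R\<^esub>i\<in>{..j}. F i (j - i))"
    proof (rule R.finsum_cong')
      fix i assume "i \<in> {..j}"
      then have i: "n - j + (j - i) = n - i" "n - i - (j - i) = n - j" using j by auto
      show "(\<tau> ^^ (n - j)) ((\<tau> ^^ (j - i)) (f i) \<otimes>\<^bsub>R\<^esub> g (j - i)) \<otimes>\<^bsub>R\<^esub> h (n - j) = F i (j - i)"
        unfolding F_def i
        by (simp add: pow_mult R.m_assoc i(1)[symmetric] funpow_add del: i)
    qed auto
    finally show "(\<tau> ^^ (n - j)) (\<Oplus>\<^bsub>R\<^esub>i\<in>{..j}. (\<tau> ^^ (j - i)) (f i) \<otimes>\<^bsub>R\<^esub> g (j - i)) \<otimes>\<^bsub>R\<^esub> h (n - j)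
       = (\<Oplus>\<^bsub>R\<^esub>i\<in>{..j}. F i (j - i))" .
  qed (auto intro!: R.finsum_closed)
  also have "\<dots> = (\<Oplus>\<^bsub>R\<^esub>i\<in>{..n}. \<Oplus>\<^bsub>R\<^esub>l\<in>{..n - i}. F i l)"
    by (rule R.finsum_triangle) simp
  also have "\<dots> = (f \<otimes>\<^bsub>S\<^esub> (g \<otimes>\<^bsub>S\<^esub> h)) n"
    unfolding S_simps
  proof (rule R.finsum_cong')
    fix i
    show "(\<Oplus>\<^bsub>R\<^esub>l\<in>{..n - i}. F i l) = (\<tau> ^^ (n - i)) (f i) \<otimes>\<^bsub>R\<^esub>
       (\<Oplus>\<^bsub>R\<^esub>l\<in>{..n - i}. (\<tau> ^^ (n - i - l)) (g l) \<otimes>\<^bsub>R\<^esub> h (n - i - l))"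
      unfolding F_def by (subst R.finsum_rdistr) (auto simp: Pi_def)
  qed (auto intro!: R.finsum_closed)
  finally show "((f \<otimes>\<^bsub>S\<^esub> g) \<otimes>\<^bsub>S\<^esub> h) n = (f \<otimes>\<^bsub>S\<^esub> (g \<otimes>\<^bsub>S\<^esub> h)) n" .
qed

lemma S_one_mult:
  assumes "f \<in> carrier S"
  shows "\<one>\<^bsub>S\<^esub> \<otimes>\<^bsub>S\<^esub> f = f" "f \<otimes>\<^bsub>S\<^esub> \<one>\<^bsub>S\<^esub> = f"
proof -
  have c [simp]: "f i \<in> carrier R" for i using assms by (auto simp: S_simps)
  show "\<one>\<^bsub>S\<^esub> \<otimes>\<^bsub>S\<^esub> f = f"
  proof
    fix n
    show "(\<one>\<^bsub>S\<^esub> \<otimes>\<^bsub>S\<^esub> f) n = f n"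
      unfolding S_simps by (subst R.finsum_zero_except[where i = 0]) auto
  qed
  show "f \<otimes>\<^bsub>S\<^esub> \<one>\<^bsub>S\<^esub> = f"
  proof
    fix n
    show "(f \<otimes>\<^bsub>S\<^esub> \<one>\<^bsub>S\<^esub>) n = f n"
      unfolding S_simps by (subst R.finsum_zero_except[where i = n]) auto
  qed
qed

lemma S_distr:
  assumes "f \<in> carrier S" "g \<in> carrier S" "h \<in> carrier S"
  shows "(f \<oplus>\<^bsub>S\<^esub> g) \<otimes>\<^bsub>S\<^esub> h = f \<otimes>\<^bsub>S\<^esub> h \<oplus>\<^bsub>S\<^esub> g \<otimes>\<^bsub>S\<^esub> h"
    and "h \<otimes>\<^bsub>S\<^esub> (f \<oplus>\<^bsub>S\<^esub> g) = h \<otimes>\<^bsub>S\<^esub> f \<oplus>\<^bsub>S\<^esub> h \<otimes>\<^bsub>S\<^esub> g"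
proof -
  have c [simp]: "f i \<in> carrier R" "g i \<in> carrier R" "h i \<in> carrier R" for i
    using assms by (auto simp: S_simps)
  show "(f \<oplus>\<^bsub>S\<^esub> g) \<otimes>\<^bsub>S\<^esub> h = f \<otimes>\<^bsub>S\<^esub> h \<oplus>\<^bsub>S\<^esub> g \<otimes>\<^bsub>S\<^esub> h"
    unfolding S_simps
    by (rule ext, subst R.finsum_addf[symmetric])
       (auto simp: pow_add R.l_distr intro!: R.finsum_cong')
  show "h \<otimes>\<^bsub>S\<^esub> (f \<oplus>\<^bsub>S\<^esub> g) = h \<otimes>\<^bsub>S\<^esub> f \<oplus>\<^bsub>S\<^esub> h \<otimes>\<^bsub>S\<^esub> g"
    unfolding S_simps
    by (rule ext, subst R.finsum_addf[symmetric])
       (auto simp: R.r_distr intro!: R.finsum_cong')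
qed

lemma S_abelian_group: "abelian_group S"
proof (rule abelian_groupI)
  fix f assume f: "f \<in> carrier S"
  show "\<exists>g\<in>carrier S. g \<oplus>\<^bsub>S\<^esub> f = \<zero>\<^bsub>S\<^esub>"
    using f by (intro bexI[of _ "\<lambda>n. \<ominus>\<^bsub>R\<^esub> f n"]) (auto simp: S_simps Pi_iff R.l_neg)
qed (auto simp: S_simps Pi_iff R.a_ac fun_eq_iff)

lemma S_ring: "ring S"
proof (rule ringI)
  show "Group.monoid S"
    by (rule monoidI) (auto simp: S_mult_closed S_mult_assoc S_one_mult, auto simp: S_simps)
qed (auto simp: S_abelian_group S_distr)

theorem S_field_algebra: "field_algebra K S"
proof (intro field_algebra.intro field_algebra_axioms.intro moduleI S_ring S_abelian_group)
  fix a f g assume a: "a \<in> carrier K" and f: "f \<in> carrier S" and g: "g \<in> carrier S"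
  have c [simp]: "f i \<in> carrier R" "g i \<in> carrier R" for i
    using f g by (auto simp: S_simps)
  show "(a \<odot>\<^bsub>S\<^esub> f) \<otimes>\<^bsub>S\<^esub> g = a \<odot>\<^bsub>S\<^esub> (f \<otimes>\<^bsub>S\<^esub> g)"
    unfolding S_simps using a
    by (auto simp: smult_finsum pow_smult smult_mult_left fun_eq_iff intro!: R.finsum_cong')
  show "f \<otimes>\<^bsub>S\<^esub> (a \<odot>\<^bsub>S\<^esub> g) = a \<odot>\<^bsub>S\<^esub> (f \<otimes>\<^bsub>S\<^esub> g)"
    unfolding S_simps using a
    by (auto simp: smult_finsum smult_mult_right fun_eq_iff intro!: R.finsum_cong')
qed (auto simp: S_simps Pi_iff smult_l_distr smult_r_distr smult_assoc1 K.field_axioms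
       K.is_cring)

lemma monom_closed: "r \<in> carrier R \<Longrightarrow> series_monom R n r \<in> carrier S"
  by (auto simp: series_monom_def S_simps)

theorem monom_mult:
  assumes "r \<in> carrier R" "s \<in> carrier R"
  shows "series_monom R m r \<otimes>\<^bsub>S\<^esub> series_monom R n s
    = series_monom R (m + n) ((\<tau> ^^ n) r \<otimes>\<^bsub>R\<^esub> s)"
proof
  fix l
  show "(series_monom R m r \<otimes>\<^bsub>S\<^esub> series_monom R n s) l
    = series_monom R (m + n) ((\<tau> ^^ n) r \<otimes>\<^bsub>R\<^esub> s) l"
  proof (cases "m \<le> l")
    case True
    then show ?thesis
      using assms unfolding S_simps
      by (subst R.finsum_zero_except[where i = m]) (auto simp: series_monom_def)
  next
    case False
    then show ?thesis
      using assms unfolding S_simps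
      by (subst R.finsum_zero_except[where i = 0]) (auto simp: series_monom_def)
  qed
qed

text \<open>The defining relation \<open>r x = x \<tau>(r)\<close>.\<close>

corollary skew_relation:
  assumes "r \<in> carrier R"
  shows "series_monom R 0 r \<otimes>\<^bsub>S\<^esub> series_monom R 1 \<one>\<^bsub>R\<^esub>
    = series_monom R 1 \<one>\<^bsub>R\<^esub> \<otimes>\<^bsub>S\<^esub> series_monom R 0 (\<tau> r)"
  using assms by (simp add: monom_mult)

theorem extend_aut_automorphism:
  assumes q: "q \<in> carrier K - {\<zero>\<^bsub>K\<^esub>}"
  shows "extend_aut K R q \<tau> \<in> algebra_automorphisms K S"
proof -
  let ?t = "extend_aut K R q \<tau>"
  have qc [simp]: "q \<in> carrier K" using q by auto
  have qu: "q [^]\<^bsub>K\<^esub> i \<in> Units K" for i :: nat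
    using q by (induct i) (auto simp: K.field_Units K.integral_iff)
  have lin: "?t \<in> linear_maps K S S"
    unfolding linear_maps_def extend_aut_def S_simps
    by (auto simp: tau_add tau_smult smult_r_distr Pi_iff fun_eq_iff smult_assoc1[symmetric]
        K.m_comm)
  have "?t \<in> ring_hom S S"
  proof (rule ring_hom_memI)
    fix f g assume f: "f \<in> carrier S" and g: "g \<in> carrier S"
    have c [simp]: "f i \<in> carrier R" "g i \<in> carrier R" for i
      using f g by (auto simp: S_simps)
    show "?t (f \<otimes>\<^bsub>S\<^esub> g) = ?t f \<otimes>\<^bsub>S\<^esub> ?t g"
    proof
      fix n
      have "?t (f \<otimes>\<^bsub>S\<^esub> g) n
        = (\<Oplus>\<^bsub>R\<^esub>i\<in>{..n}. (q [^]\<^bsub>K\<^esub> n) \<odot>\<^bsub>R\<^esub> \<tau> ((\<tau> ^^ (n - i)) (f i) \<otimes>\<^bsub>R\<^esub> g (n - i)))"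
        unfolding extend_aut_def S_simps by (simp add: tau_finsum smult_finsum)
      also have "\<dots> = (?t f \<otimes>\<^bsub>S\<^esub> ?t g) n"
        unfolding extend_aut_def S_simps
      proof (rule R.finsum_cong')
        fix i assume "i \<in> {..n}"
        then have n: "q [^]\<^bsub>K\<^esub> n = (q [^]\<^bsub>K\<^esub> i) \<otimes>\<^bsub>K\<^esub> (q [^]\<^bsub>K\<^esub> (n - i))"
          by (simp add: K.nat_pow_mult)
        show "(q [^]\<^bsub>K\<^esub> n) \<odot>\<^bsub>R\<^esub> \<tau> ((\<tau> ^^ (n - i)) (f i) \<otimes>\<^bsub>R\<^esub> g (n - i))
          = (\<tau> ^^ (n - i)) ((q [^]\<^bsub>K\<^esub> i) \<odot>\<^bsub>R\<^esub> \<tau> (f i)) \<otimes>\<^bsub>R\<^esub> ((q [^]\<^bsub>K\<^esub> (n - i)) \<odot>\<^bsub>R\<^esub> \<tau> (g (n - i)))"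
          unfolding n
          by (simp add: pow_smult tau_mult smult_mult_left smult_mult_right
              smult_assoc1[symmetric] K.m_comm funpow_swap1)
      qed auto
      finally show "?t (f \<otimes>\<^bsub>S\<^esub> g) n = (?t f \<otimes>\<^bsub>S\<^esub> ?t g) n" .
    qed
  qed (use lin in \<open>auto simp: linear_maps_def extend_aut_def S_simps Pi_iff fun_eq_iff\<close>)
  moreover have "bij_betw ?t (carrier S) (carrier S)"
  proof (rule bij_betwI)
    let ?u = "\<lambda>f i. inv_into (carrier R) \<tau> (inv\<^bsub>K\<^esub> (q [^]\<^bsub>K\<^esub> i) \<odot>\<^bsub>R\<^esub> f i)"
    have inv_c: "r \<in> carrier R \<Longrightarrow> inv_into (carrier R) \<tau> r \<in> carrier R" for r
      using tau_bij by (metis bij_betw_def inv_into_into)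
    show "?t \<in> carrier S \<rightarrow> carrier S" using lin by (simp add: linear_maps_def)
    show "?u \<in> carrier S \<rightarrow> carrier S" using qu by (auto simp: S_simps Pi_iff intro!: inv_c)
    fix f assume f: "f \<in> carrier S"
    then have c [simp]: "f i \<in> carrier R" for i by (auto simp: S_simps)
    have "inv\<^bsub>K\<^esub> (q [^]\<^bsub>K\<^esub> i) \<odot>\<^bsub>R\<^esub> ((q [^]\<^bsub>K\<^esub> i) \<odot>\<^bsub>R\<^esub> \<tau> (f i)) = \<tau> (f i)" for i
      using qu[of i] by (simp add: smult_assoc1[symmetric])
    then show "?u (?t f) = f"
      using tau_bij by (auto simp: extend_aut_def bij_betw_inv_into_left)
    show "?t (?u f) = f"
      unfolding extend_aut_def using qu tau_bij
      by (auto simp: bij_betw_inv_into_right smult_assoc1[symmetric])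
  qed
  ultimately show ?thesis
    using lin by (simp add: algebra_automorphisms_def ring_iso_def)
qed

theorem extend_aut_const:
  assumes "q \<in> carrier K" "r \<in> carrier R"
  shows "extend_aut K R q \<tau> (series_monom R 0 r) = series_monom R 0 (\<tau> r)"
  using assms by (auto simp: extend_aut_def series_monom_def fun_eq_iff)

theorem extend_aut_var:
  assumes "q \<in> carrier K"
  shows "extend_aut K R q \<tau> (series_monom R 1 \<one>\<^bsub>R\<^esub>)
    = series_monom R 1 \<one>\<^bsub>R\<^esub> \<otimes>\<^bsub>S\<^esub> series_monom R 0 (q \<odot>\<^bsub>R\<^esub> \<one>\<^bsub>R\<^esub>)"
  using assms by (subst monom_mult) (auto simp: extend_aut_def series_monom_def fun_eq_iff)

end

end

theory Submission
  imports Defs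
begin

text \<open>
  The product rule for \<open>d\<close> is multiplicativity of \<open>\<Psi>\<close> read off coefficient by
  coefficient, and likewise for part (b). The only point that is not a mere comparison of
  coefficients is that a higher \<open>\<tau>\<close>-derivation makes \<open>\<Psi>\<close> unital: \<open>\<Psi> 1\<close> is an idempotent
  with constant term \<open>1\<close>, which forces it to be \<open>1\<close>.
\<close>

context skew_series
begin

text \<open>Induction on the degree. Once the coefficients of degrees 1 to \<open>n\<close> vanish,
  only the two end terms survive in degree \<open>Suc n\<close> of \<open>e\<close> times
  \<open>e\<close>. Each equals \<open>e (Suc n)\<close>, so this coefficient equals its own double
  and cancels to zero in the additive group.\<close>

lemma idempotent_series_eq_one:
  assumes e: "e \<in> carrier S" and idem: "e \<otimes>\<^bsub>S\<^esub> e = e" and e0: "e 0 = \<one>\<^bsub>R\<^esub>"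
  shows "e = \<one>\<^bsub>S\<^esub>"
proof -
  have c [simp]: "e i \<in> carrier R" for i using e by (auto simp: S_simps)
  have "e (Suc n) = \<zero>\<^bsub>R\<^esub>" for n
  proof (induct n rule: less_induct)
    case (less n)
    let ?f = "\<lambda>i. (\<tau> ^^ (Suc n - i)) (e i) \<otimes>\<^bsub>R\<^esub> e (Suc n - i)"
    have f: "?f \<in> A \<rightarrow> carrier R" for A by auto
    have z: "?f i = \<zero>\<^bsub>R\<^esub>" if "i \<in> {..n}" "i \<noteq> 0" for i
    proof -
      \<comment> \<open>The induction hypothesis speaks of \<open>e (Suc m)\<close> with
        \<open>m < n\<close>, so it covers \<open>e i\<close> at \<open>m = i - 1\<close>.\<close>
      have "e i = \<zero>\<^bsub>R\<^esub>" using less[of "i - 1"] that by (cases i) auto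
      then show ?thesis by simp
    qed
    have "e (Suc n) = (\<Oplus>\<^bsub>R\<^esub>i\<in>{..Suc n}. ?f i)"
      using fun_cong[OF idem, of "Suc n"] by (simp only: S_simps)
    also have "\<dots> = ?f (Suc n) \<oplus>\<^bsub>R\<^esub> (\<Oplus>\<^bsub>R\<^esub>i\<in>{..n}. ?f i)"
      by (rule R.finsum_Suc[OF f])
    also have "(\<Oplus>\<^bsub>R\<^esub>i\<in>{..n}. ?f i) = ?f 0"
      by (rule R.finsum_zero_except) (use z in auto)
    \<comment> \<open>The factor \<open>e 0\<close> in \<open>?f (Suc n)\<close> is 1, and so is the
      left factor of \<open>?f 0\<close>, since powers of \<open>\<tau>\<close> fix 1.\<close>
    finally have "e (Suc n) \<oplus>\<^bsub>R\<^esub> e (Suc n) = e (Suc n)"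
      by (simp add: e0)
    then show ?case using R.add.l_cancel_one'[of "e (Suc n)" "e (Suc n)"] by simp
  qed
  then show ?thesis
    using e0 by (auto simp: S_simps fun_eq_iff gr0_conv_Suc)
qed

text \<open>Additivity of \<open>series_map d\<close> comes from linearity of each
  \<open>d i\<close>. Both sides then amount to multiplicativity, except that a ring homomorphism
  must also preserve 1.\<close>

theorem higher_derivation_iff_ring_hom:
  assumes lin: "\<And>i. d i \<in> linear_maps K R R"
    and d0: "\<And>r. r \<in> carrier R \<Longrightarrow> d 0 r = r"
  shows "higher_derivation K R \<tau> d \<longleftrightarrow> series_map d \<in> ring_hom R S"
proof -
  have closed: "d i r \<in> carrier R" if "r \<in> carrier R" for i r
    using lin[of i] that by (auto simp: linear_maps_def)
  have mem: "series_map d r \<in> carrier S" if "r \<in> carrier R" for r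
    using that by (simp add: series_map_def S_simps closed)
  have add: "series_map d (r \<oplus>\<^bsub>R\<^esub> s) = series_map d r \<oplus>\<^bsub>S\<^esub> series_map d s"
    if "r \<in> carrier R" "s \<in> carrier R" for r s
  proof
    fix i
    show "series_map d (r \<oplus>\<^bsub>R\<^esub> s) i = (series_map d r \<oplus>\<^bsub>S\<^esub> series_map d s) i"
      using lin[of i] that by (simp add: series_map_def S_simps linear_maps_def)
  qed
  \<comment> \<open>The right side of the product rule for \<open>d n\<close> is literally
    coefficient \<open>n\<close> of a product in \<open>S\<close>.\<close>
  have hd: "higher_derivation K R \<tau> d \<longleftrightarrow>
    (\<forall>r\<in>carrier R. \<forall>s\<in>carrier R.
      series_map d (r \<otimes>\<^bsub>R\<^esub> s) = series_map d r \<otimes>\<^bsub>S\<^esub> series_map d s)" (is "_ \<longleftrightarrow> ?mult")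
  proof -
    have "higher_derivation K R \<tau> d \<longleftrightarrow>
      (\<forall>n. \<forall>r\<in>carrier R. \<forall>s\<in>carrier R.
        series_map d (r \<otimes>\<^bsub>R\<^esub> s) n = (series_map d r \<otimes>\<^bsub>S\<^esub> series_map d s) n)"
      unfolding higher_derivation_def series_map_def S_simps(2) by (simp add: lin d0)
    then show ?thesis unfolding fun_eq_iff by blast
  qed
  \<comment> \<open>Multiplicativity at the pair (1, 1) gives the idempotent; its constant term is
    \<open>d 0\<close> applied to 1.\<close>
  have one: "series_map d \<one>\<^bsub>R\<^esub> = \<one>\<^bsub>S\<^esub>" if ?mult
  proof (rule idempotent_series_eq_one)
    show "series_map d \<one>\<^bsub>R\<^esub> \<otimes>\<^bsub>S\<^esub> series_map d \<one>\<^bsub>R\<^esub> = series_map d \<one>\<^bsub>R\<^esub>"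
      using that[rule_format, of "\<one>\<^bsub>R\<^esub>" "\<one>\<^bsub>R\<^esub>"] by simp
  qed (simp_all add: mem, simp add: series_map_def d0)
  show ?thesis
  proof
    assume "higher_derivation K R \<tau> d"
    then have m: ?mult by (simp only: hd)
    show "series_map d \<in> ring_hom R S"
      using m by (simp add: ring_hom_memI mem add one[OF m])
  next
    assume "series_map d \<in> ring_hom R S"
    then show "higher_derivation K R \<tau> d"
      unfolding hd by (simp add: ring_hom_mult)
  qed
qed

end

text \<open>Coefficient \<open>i\<close> of the two series is \<open>q^i \<tau>(d i r)\<close> and
  \<open>d i (\<tau> r)\<close>, so equality of series is the q-skew identity for all
  \<open>i\<close> at once.\<close>

theorem higher_q_skew_derivation_iff_commute:
  assumes "higher_derivation K R \<tau> d"
  shows "higher_q_skew_derivation K R q \<tau> d \<longleftrightarrow>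
    (\<forall>r\<in>carrier R. extend_aut K R q \<tau> (series_map d r) = series_map d (\<tau> r))"
  using assms
  by (auto simp only: higher_q_skew_derivation_def extend_aut_def series_map_def fun_eq_iff)

theorem proposition2p3:
  fixes K :: "('k, 'c) ring_scheme" and R :: "('k, 'a, 'm) module_scheme"
    and q :: 'k and \<tau> :: "'a \<Rightarrow> 'a" and d :: "nat \<Rightarrow> 'a \<Rightarrow> 'a"
  assumes "field_algebra K R"
    and "q \<in> carrier K - {\<zero>\<^bsub>K\<^esub>}"
    and "\<And>i. d i \<in> linear_maps K R R"
    and "\<And>r. r \<in> carrier R \<Longrightarrow> d 0 r = r"
    and "\<tau> \<in> algebra_automorphisms K R"
  shows "(higher_derivation K R \<tau> d \<longleftrightarrow> series_map d \<in> ring_hom R (skew_power_series R \<tau>)) \<and>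
    (higher_derivation K R \<tau> d \<longrightarrow>
      (higher_q_skew_derivation K R q \<tau> d \<longleftrightarrow>
        (\<forall>r\<in>carrier R. extend_aut K R q \<tau> (series_map d r) = series_map d (\<tau> r))))"
proof -
  interpret skew_series K R \<tau>
    using assms(1,5) by (intro skew_series.intro skew_series_axioms.intro)
  show ?thesis
    using higher_derivation_iff_ring_hom[of d, OF assms(3,4)]
      higher_q_skew_derivation_iff_commute[of K R \<tau> d q]
    by (intro conjI impI) simp_all
qed

end
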